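(* Let $X$ be a reflexive real Banach space and let $\{F_n\}$ be a sequence of selfdual Lagrangians on $X\times X^*$. If $F:X\times X^*\to\mathbb{R}\cup\{+\infty\}$ is a selfdual Lagrangian that is a $\Gamma$-limit of $\{F_n\}$, then the graphs of $\bar\partial F_n$ converge to the graph of $\bar\partial F$ in $X\times X^*$ in the sense of Kuratowski–Painlevé.
   Context: A selfdual Lagrangian on $X\times X^*$ is a convex lower semicontinuous function $L:X\times X^*\to\mathbb{R}\cup\{+\infty\}$ with $L^*(u^*,u)=L(u,u^* )$ for all $(u,u^* )$, where $L^*(u^*,u)=\sup\{\langle v,u^*\rangle+\langle u,v^*\rangle-L(v,v^* ):(v,v^* )\in X\times X^*\}$. Its vector field is $\bar\partial L(u)=\{u^*\in X^*:L(u,u^* )=\langle u,u^*\rangle\}$, with graph $\{(u,u^* ):u^*\in\bar\partial L(u)\}$. $\{F_n\}$ $\Gamma$-converges to $F$ on $X\times X^*$ if (1) $F(u,u^* )\le\liminf_nF_n(u_n,u^*_n)$ whenever $(u_n,u_n^* )\to(u,u^* )$ strongly, and (2) for every $(u,u^* )$ there is a sequence $(u_n,u_n^* )\to(u,u^* )$ strongly with $\lim_nF_n(u_n,u_n^* )=F(u,u^* )$. For subsets $A_n$ of a Banach space $Y$, $Li(A_n)$ is the set of $y\in Y$ that are strong limits of a sequence $y_n$ with $y_n\in A_n$, and $Ls(A_n)$ is the set of $y\in Y$ for which there are indices $n(k)\to\infty$ and $y_k\in A_{n(k)}$ with $y_k\to y$ strongly. $A_n$ converges to $A$ in the sense of Kuratowski–Painlevé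 if $Ls(A_n)=A=Li(A_n)$. Here $Y=X\times X^*$. *)

theory Defs
  imports "HOL-Analysis.Analysis"
begin

text \<open>The dual of \<open>'a\<close> is the type \<open>'a \<Rightarrow>\<^sub>L real\<close> of bounded linear functionals with the operator
  norm; \<open>X \<times> X\<^sup>*\<close> carries the product norm. Extended real values are taken in \<^typ>\<open>ereal\<close>.\<close>

definition bidual_embedding :: "'a::real_normed_vector \<Rightarrow> (('a \<Rightarrow>\<^sub>L real) \<Rightarrow>\<^sub>L real)"
  where "bidual_embedding x = Blinfun (\<lambda>f. blinfun_apply f x)"

lemma bidual_embedding_apply: "blinfun_apply (bidual_embedding x) f = blinfun_apply f x"
  unfolding bidual_embedding_def
  by (simp add: bounded_linear_Blinfun_apply blinfun.bounded_linear_left)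

definition reflexive_space :: "'a::banach itself \<Rightarrow> bool"
  where "reflexive_space _ \<longleftrightarrow> surj (bidual_embedding :: 'a \<Rightarrow> _)"

text \<open>Only used for functions that avoid \<open>-\<infinity>\<close>, so the sum on the right is never \<open>\<infinity> - \<infinity>\<close>;
  in \<^typ>\<open>ereal\<close>, \<open>0 * \<infinity> = 0\<close>, so the cases \<open>s = 0\<close> and \<open>t = 0\<close> are trivially true.\<close>

definition convex_ereal :: "('a::real_vector \<Rightarrow> ereal) \<Rightarrow> bool"
  where "convex_ereal f \<longleftrightarrow>
    (\<forall>x y. \<forall>s\<ge>0. \<forall>t\<ge>0. s + t = 1 \<longrightarrow>
      f (s *\<^sub>R x + t *\<^sub>R y) \<le> ereal s * f x + ereal t * f y)"

definition lower_semicontinuous :: "('a::topological_space \<Rightarrow> ereal) \<Rightarrow> bool"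
  where "lower_semicontinuous f \<longleftrightarrow> (\<forall>x. f x \<le> Liminf (at x) f)"

definition lagrangian_conjugate ::
    "('a::real_normed_vector \<times> ('a \<Rightarrow>\<^sub>L real) \<Rightarrow> ereal) \<Rightarrow> ('a \<Rightarrow>\<^sub>L real) \<times> 'a \<Rightarrow> ereal"
  where "lagrangian_conjugate L = (\<lambda>(u', u).
    (SUP (v, v') \<in> UNIV. ereal (blinfun_apply u' v + blinfun_apply v' u) - L (v, v')))"

definition selfdual_lagrangian ::
    "('a::real_normed_vector \<times> ('a \<Rightarrow>\<^sub>L real) \<Rightarrow> ereal) \<Rightarrow> bool"
  where "selfdual_lagrangian L \<longleftrightarrow>
    (\<forall>p. L p \<noteq> -\<infinity>) \<and> convex_ereal L \<and> lower_semicontinuous L \<and>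
    (\<forall>u u'. lagrangian_conjugate L (u', u) = L (u, u'))"

definition lagrangian_vector_field ::
    "('a::real_normed_vector \<times> ('a \<Rightarrow>\<^sub>L real) \<Rightarrow> ereal) \<Rightarrow> 'a \<Rightarrow> ('a \<Rightarrow>\<^sub>L real) set"
  where "lagrangian_vector_field L u = {u'. L (u, u') = ereal (blinfun_apply u' u)}"

definition set_valued_graph :: "('a \<Rightarrow> 'b set) \<Rightarrow> ('a \<times> 'b) set"
  where "set_valued_graph T = {(u, w). w \<in> T u}"

definition gamma_converges ::
    "(nat \<Rightarrow> 'a::topological_space \<Rightarrow> ereal) \<Rightarrow> ('a \<Rightarrow> ereal) \<Rightarrow> bool"
  where "gamma_converges F G \<longleftrightarrow>
    (\<forall>x p. p \<longlonglongrightarrow> x \<longrightarrow> G x \<le> liminf (\<lambda>n. F n (p n))) \<and>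
    (\<forall>x. \<exists>p. p \<longlonglongrightarrow> x \<and> (\<lambda>n. F n (p n)) \<longlonglongrightarrow> G x)"

definition kuratowski_Li :: "(nat \<Rightarrow> 'a::topological_space set) \<Rightarrow> 'a set"
  where "kuratowski_Li A = {y. \<exists>p. (\<forall>n. p n \<in> A n) \<and> p \<longlonglongrightarrow> y}"

definition kuratowski_Ls :: "(nat \<Rightarrow> 'a::topological_space set) \<Rightarrow> 'a set"
  where "kuratowski_Ls A =
    {y. \<exists>r p. filterlim r at_top sequentially \<and> (\<forall>k. p k \<in> A (r k)) \<and> p \<longlonglongrightarrow> y}"

definition kuratowski_painleve_converges ::
    "(nat \<Rightarrow> 'a::topological_space set) \<Rightarrow> 'a set \<Rightarrow> bool"
  where "kuratowski_painleve_converges A B \<longleftrightarrow> kuratowski_Ls A = B \<and> kuratowski_Li A = B"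

end

theory Submission
  imports Defs
begin

text \<open>
  By selfduality, \<open>L (u, u') \<ge> \<langle>u, u'\<rangle>\<close> holds everywhere, so the graph of the vector field of \<open>L\<close>
  is the set of zeros of the nonnegative gap \<open>L (u, u') - \<langle>u, u'\<rangle>\<close>. The convergence of graphs
  splits into two inclusions, since the lower Kuratowski limit lies inside the upper one.

  The upper limit of the graphs lies in the graph of \<open>G\<close> by the liminf half of \<open>\<Gamma>\<close>-convergence:
  along points of the graphs the values of \<open>F n\<close> are pairings, which converge because the
  pairing is continuous, so the gap of \<open>G\<close> at a limit point is at most zero.

  For the other inclusion, a recovery sequence of a point of the graph of \<open>G\<close> has gaps
  \<open>\<epsilon> n\<close> that tend to zero, but its members need not lie on the graphs. They can be moved there by a
  Bronsted--Rockafellar estimate without loss, \<open>selfdual_lagrangian_graph_near\<close>: a point with gap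
  \<open>\<epsilon>\<close> is within \<open>sqrt (2 * \<epsilon>)\<close> of the graph. To obtain it for a point \<open>(u, u')\<close>, consider the convex
  function
  \<open>L (x, x') - \<langle>x, u'\<rangle> - \<langle>u, x'\<rangle> + \<langle>u, u'\<rangle> + (\<parallel>x - u\<parallel>\<^sup>2 + \<parallel>x' - u'\<parallel>\<^sup>2) / 2\<close>,
  which is nonnegative because \<open>L\<close> dominates the pairing. Fenchel duality (\<open>convex_sandwich\<close>)
  separates \<open>L\<close> from the remaining terms by a bounded functional on \<open>X \<times> X\<^sup>*\<close>. By
  reflexivity the functional is a point \<open>(a', a)\<close> of \<open>X\<^sup>* \<times> X\<close>, and since the conjugate of
  \<open>L\<close> is \<open>L\<close> with its arguments exchanged, the same function is at most zero at \<open>(a, a')\<close>. Equality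
  in every estimate puts \<open>(a, a')\<close> on the graph and gives
  \<open>\<langle>a - u, a' - u'\<rangle> = - \<parallel>a - u\<parallel>\<^sup>2 = - \<parallel>a' - u'\<parallel>\<^sup>2\<close>; the Fenchel--Young inequality between
  \<open>(a, a')\<close> and \<open>(u, u')\<close> bounds this below by \<open>- \<epsilon>\<close>.

  The duality rests on the Hahn--Banach theorem in the form that a convex function has a
  subgradient wherever it is locally bounded above (\<open>convex_on_UNIV_subgradient\<close>), which follows
  from Zorn's lemma: a minimal convex function vanishing at the origin is linear.
\<close>

section \<open>Subgradients of convex functions\<close>

text \<open>A convex combination of near-minimizers for two parameters is a competitor for the
  combined parameter.\<close>

lemma convex_on_marginal:
  fixes \<Phi> :: "'a::real_vector \<Rightarrow> 'b::real_vector \<Rightarrow> real"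
  assumes conv: "convex_on (UNIV \<times> D) (\<lambda>(x, y). \<Phi> x y)"
    and ne: "D \<noteq> {}"
    and bdd: "\<And>x. bdd_below (\<Phi> x ` D)"
  shows "convex_on UNIV (\<lambda>x. INF y\<in>D. \<Phi> x y)"
  unfolding convex_on_def
proof (intro conjI ballI allI impI convex_UNIV)
  fix x1 x2 :: 'a and u v :: real
  assume u: "0 \<le> u" and v: "0 \<le> v" and uv: "u + v = 1"
  let ?m = "\<lambda>x. INF y\<in>D. \<Phi> x y"
  show "?m (u *\<^sub>R x1 + v *\<^sub>R x2) \<le> u * ?m x1 + v * ?m x2"
  proof (rule field_le_epsilon)
    fix e :: real assume e: "0 < e"
    have "\<exists>y\<in>D. \<Phi> x y < ?m x + e" for x
      using cINF_less_iff[OF ne bdd, of x "?m x + e"] e by simp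
    then obtain y1 y2 where y: "y1 \<in> D" "y2 \<in> D"
      and 1: "\<Phi> x1 y1 \<le> ?m x1 + e" and 2: "\<Phi> x2 y2 \<le> ?m x2 + e"
      by (meson less_imp_le)
    have "convex (UNIV \<times> D :: ('a \<times> 'b) set)"
      using conv by (simp add: convex_on_def)
    then have "u *\<^sub>R (x1, y1) + v *\<^sub>R (x2, y2) \<in> UNIV \<times> D"
      using y u v uv by (intro convexD) auto
    then have "u *\<^sub>R y1 + v *\<^sub>R y2 \<in> D" by simp
    then have "?m (u *\<^sub>R x1 + v *\<^sub>R x2) \<le> \<Phi> (u *\<^sub>R x1 + v *\<^sub>R x2) (u *\<^sub>R y1 + v *\<^sub>R y2)"
      by (rule cINF_lower[OF bdd])
    also have "\<dots> \<le> u * \<Phi> x1 y1 + v * \<Phi> x2 y2"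
    proof -
      have "(x1, y1) \<in> UNIV \<times> D" "(x2, y2) \<in> UNIV \<times> D" using y by auto
      from conv[unfolded convex_on_def, THEN conjunct2, rule_format, OF this u v uv]
      show ?thesis by simp
    qed
    also have "\<dots> \<le> u * (?m x1 + e) + v * (?m x2 + e)"
      using 1 2 u v by (intro add_mono mult_left_mono)
    also have "\<dots> = u * ?m x1 + v * ?m x2 + (u + v) * e"
      by (simp add: algebra_simps)
    finally show "?m (u *\<^sub>R x1 + v *\<^sub>R x2) \<le> u * ?m x1 + v * ?m x2 + e"
      using uv by simp
  qed
qed

text \<open>Infima of convex functions need not be convex; in a chain, however, one member is
  nearly optimal at two given points simultaneously. This provides the lower bounds of chains that
  Zorn's lemma asks for.\<close>

lemma convex_on_Inf_chain:
  fixes C :: "('a::real_vector \<Rightarrow> real) set"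
  assumes conv: "\<And>k. k \<in> C \<Longrightarrow> convex_on UNIV k"
    and chain: "\<And>j k. j \<in> C \<Longrightarrow> k \<in> C \<Longrightarrow> j \<le> k \<or> k \<le> j"
    and ne: "C \<noteq> {}"
    and bdd: "\<And>x. bdd_below ((\<lambda>k. k x) ` C)"
  shows "convex_on UNIV (\<lambda>x. INF k\<in>C. k x)"
  unfolding convex_on_def
proof (intro conjI ballI allI impI convex_UNIV)
  fix x1 x2 :: 'a and u v :: real
  assume u: "0 \<le> u" and v: "0 \<le> v" and uv: "u + v = 1"
  let ?m = "\<lambda>x. INF k\<in>C. k x"
  show "?m (u *\<^sub>R x1 + v *\<^sub>R x2) \<le> u * ?m x1 + v * ?m x2"
  proof (rule field_le_epsilon)
    fix e :: real assume e: "0 < e"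
    have "\<exists>k\<in>C. k x < ?m x + e" for x
      using cINF_less_iff[OF ne bdd, of x "?m x + e"] e by simp
    then obtain k1 k2 where k12: "k1 \<in> C" "k2 \<in> C"
      and "k1 x1 \<le> ?m x1 + e" "k2 x2 \<le> ?m x2 + e"
      by (meson less_imp_le)
    with chain[OF k12] obtain k where k: "k \<in> C" "k x1 \<le> ?m x1 + e" "k x2 \<le> ?m x2 + e"
      by (meson le_funD order_trans)
    have "?m (u *\<^sub>R x1 + v *\<^sub>R x2) \<le> k (u *\<^sub>R x1 + v *\<^sub>R x2)"
      by (rule cINF_lower[OF bdd k(1)])
    also have "\<dots> \<le> u * k x1 + v * k x2"
      using conv[OF k(1)] u v uv by (simp add: convex_on_def)
    also have "\<dots> \<le> u * (?m x1 + e) + v * (?m x2 + e)"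
      using k u v by (intro add_mono mult_left_mono)
    also have "\<dots> = u * ?m x1 + v * ?m x2 + (u + v) * e"
      by (simp add: algebra_simps)
    finally show "?m (u *\<^sub>R x1 + v *\<^sub>R x2) \<le> u * ?m x1 + v * ?m x2 + e"
      using uv by simp
  qed
qed

lemma convex_on_UNIV_midpoint:
  fixes k :: "'a::real_vector \<Rightarrow> real"
  assumes "convex_on UNIV k"
  shows "k ((1/2) *\<^sub>R (x + y)) \<le> (k x + k y) / 2"
  using convex_onD[OF assms, of "1/2" x y] by (simp add: scaleR_add_right)

text \<open>The one-dimensional case of the subgradient theorem: \<open>s\<close> is the right derivative at \<open>0\<close> of
  the restriction to the line through \<open>y\<close>. The slopes of chords to the left of the origin are at
  most those to the right, which makes the infimum finite and a lower bound on both sides.\<close>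

lemma convex_on_UNIV_slope_on_line:
  fixes k :: "'a::real_vector \<Rightarrow> real"
  assumes conv: "convex_on UNIV k" and k0: "k 0 = 0"
  obtains s where "\<And>t. t * s \<le> k (t *\<^sub>R y)"
proof -
  have slopes: "- k ((- r) *\<^sub>R y) / r \<le> k (t *\<^sub>R y) / t" if "0 < t" "0 < r" for t r :: real
  proof -
    have "k ((r / (t + r)) *\<^sub>R (t *\<^sub>R y) + (t / (t + r)) *\<^sub>R ((- r) *\<^sub>R y))
        \<le> (r / (t + r)) * k (t *\<^sub>R y) + (t / (t + r)) * k ((- r) *\<^sub>R y)"
    proof -
      have "0 \<le> r / (t + r)" "0 \<le> t / (t + r)" "r / (t + r) + t / (t + r) = 1"
        using that by (simp_all add: add_divide_distrib[symmetric])
      then show ?thesis using conv unfolding convex_on_def by blast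
    qed
    also have "(r / (t + r)) *\<^sub>R (t *\<^sub>R y) + (t / (t + r)) *\<^sub>R ((- r) *\<^sub>R y) = 0"
      by (simp add: mult.commute)
    finally have "0 \<le> r * k (t *\<^sub>R y) / (t + r) + t * k ((- r) *\<^sub>R y) / (t + r)"
      using k0 by simp
    then have "0 \<le> (r * k (t *\<^sub>R y) + t * k ((- r) *\<^sub>R y)) / (t + r)"
      by (simp only: add_divide_distrib)
    then have "0 \<le> r * k (t *\<^sub>R y) + t * k ((- r) *\<^sub>R y)"
      using that by (simp add: zero_le_divide_iff)
    then show ?thesis using that by (simp add: field_simps)
  qed
  define s where "s = (INF t\<in>{0<..}. k (t *\<^sub>R y) / t)"
  have bdd: "bdd_below ((\<lambda>t. k (t *\<^sub>R y) / t) ` {0<..})"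
    using slopes[of _ 1] by (intro bdd_belowI2[where m = "- k ((- 1) *\<^sub>R y) / 1"]) auto
  have "t * s \<le> k (t *\<^sub>R y)" for t :: real
  proof (cases t "0::real" rule: linorder_cases)
    case greater
    then have "s \<le> k (t *\<^sub>R y) / t"
      unfolding s_def by (intro cINF_lower[OF bdd]) simp
    with greater show ?thesis by (simp add: field_simps)
  next
    case less
    have "- k ((- (- t)) *\<^sub>R y) / (- t) \<le> s"
      unfolding s_def using less by (intro cINF_greatest slopes) auto
    with less show ?thesis by (simp add: field_simps)
  qed (simp add: k0)
  then show thesis by (rule that)
qed

text \<open>Given a supporting slope \<open>s\<close> along \<open>y\<close>, the function \<open>x \<mapsto> INF t. k (x + t *\<^sub>R y) - t * s\<close> is
  convex, vanishes at the origin and lies below \<open>k\<close>. If it equals \<open>k\<close>, then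
  \<open>k x \<le> k (x + t *\<^sub>R y) - t * s\<close> for every \<open>t\<close>, and moving back by \<open>- t\<close> yields equality: \<open>k\<close> is affine
  in the direction \<open>y\<close>.\<close>

lemma minimal_convex_imp_linear:
  fixes k :: "'a::real_vector \<Rightarrow> real"
  assumes conv: "convex_on UNIV k" and k0: "k 0 = 0"
    and minimal: "\<And>j. convex_on UNIV j \<Longrightarrow> j 0 = 0 \<Longrightarrow> j \<le> k \<Longrightarrow> j = k"
  shows "linear k"
proof -
  have "\<exists>s. \<forall>x t. k (x + t *\<^sub>R y) = k x + t * s" for y
  proof -
    obtain s where s: "\<And>t. t * s \<le> k (t *\<^sub>R y)"
      using convex_on_UNIV_slope_on_line[OF conv k0, of y] by blast
    define \<Phi> where "\<Phi> x t = k (x + t *\<^sub>R y) - t * s" for x and t :: real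
    define j where "j x = (INF t\<in>UNIV. \<Phi> x t)" for x
    \<comment> \<open>Half of \<open>t *\<^sub>R y\<close> is the midpoint of \<open>x + t *\<^sub>R y\<close> and \<open>- x\<close>.\<close>
    have lower: "- k (- x) \<le> \<Phi> x t" for x t
    proof -
      have "(t / 2) * s \<le> k ((t / 2) *\<^sub>R y)" by (rule s)
      also have "\<dots> \<le> (k (x + t *\<^sub>R y) + k (- x)) / 2"
        using convex_on_UNIV_midpoint[OF conv, of "x + t *\<^sub>R y" "- x"] by simp
      finally show ?thesis unfolding \<Phi>_def by simp
    qed
    then have bdd: "bdd_below (\<Phi> x ` UNIV)" for x
      by (intro bdd_belowI2)
    have "convex_on UNIV j"
      unfolding j_def
    proof (rule convex_on_marginal)
      show "convex_on (UNIV \<times> UNIV) (\<lambda>(x, t). \<Phi> x t)"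
        unfolding convex_on_def
      proof (intro conjI ballI allI impI)
        fix p q :: "'a \<times> real" and u v :: real
        assume uv: "0 \<le> u" "0 \<le> v" "u + v = 1"
        obtain x1 t1 x2 t2 where pq: "p = (x1, t1)" "q = (x2, t2)" by (meson surj_pair)
        have "k (u *\<^sub>R (x1 + t1 *\<^sub>R y) + v *\<^sub>R (x2 + t2 *\<^sub>R y))
            \<le> u * k (x1 + t1 *\<^sub>R y) + v * k (x2 + t2 *\<^sub>R y)"
          using conv uv by (simp add: convex_on_def)
        then show "(case u *\<^sub>R p + v *\<^sub>R q of (x, t) \<Rightarrow> \<Phi> x t)
            \<le> u * (case p of (x, t) \<Rightarrow> \<Phi> x t) + v * (case q of (x, t) \<Rightarrow> \<Phi> x t)"
          by (simp add: pq \<Phi>_def algebra_simps)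
      qed (simp add: convex_Times)
    qed (auto intro: bdd)
    moreover have "j x \<le> \<Phi> x t" for x t
      unfolding j_def by (rule cINF_lower[OF bdd]) simp
    note j_le = this
    have "j \<le> k"
      using j_le[of _ 0] by (auto simp: le_fun_def \<Phi>_def)
    moreover have "j 0 = 0"
    proof (rule antisym)
      show "j 0 \<le> 0" using j_le[of 0 0] by (simp add: \<Phi>_def k0)
      show "0 \<le> j 0"
        unfolding j_def using lower[of 0] by (intro cINF_greatest) (auto simp: k0)
    qed
    ultimately have "j = k" using \<open>j \<le> k\<close> by (intro minimal)
    then have le: "k x + t * s \<le> k (x + t *\<^sub>R y)" for x t
      using j_le[of x t] by (simp add: \<Phi>_def)
    have "k (x + t *\<^sub>R y) = k x + t * s" for x t
      using le[of x t] le[of "x + t *\<^sub>R y" "- t"] by simp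
    then show ?thesis by blast
  qed
  then obtain s where s: "\<And>x t y. k (x + t *\<^sub>R y) = k x + t * s y" by metis
  have sk: "s y = k y" for y using s[of 0 1 y] by (simp add: k0)
  show ?thesis
  proof (rule linearI)
    show "k (x + y) = k x + k y" for x y using s[of x 1 y] by (simp add: sk)
    show "k (c *\<^sub>R x) = c *\<^sub>R k x" for c x using s[of 0 c x] by (simp add: sk k0)
  qed
qed

text \<open>The algebraic Hahn--Banach theorem. Convexity and vanishing at the origin force
  \<open>k x \<ge> - k (- x) \<ge> - h (- x)\<close> for all convex \<open>k\<close> below \<open>h\<close>, so chains of such functions have finite
  infima and a minimal one exists.\<close>

lemma convex_on_UNIV_linear_minorant:
  fixes h :: "'a::real_vector \<Rightarrow> real"
  assumes conv: "convex_on UNIV h" and h0: "h 0 = 0"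
  obtains l where "linear l" "l \<le> h"
proof -
  define A where "A = {k. convex_on UNIV k \<and> k 0 = 0 \<and> k \<le> h}"
  have hA: "h \<in> A" using conv h0 by (simp add: A_def)
  have lower: "- h (- x) \<le> k x" if "k \<in> A" for k x
  proof -
    have "0 \<le> (k x + k (- x)) / 2"
      using that convex_on_UNIV_midpoint[of k x "- x"] by (simp add: A_def)
    moreover have "k (- x) \<le> h (- x)" using that by (simp add: A_def le_fun_def)
    ultimately show ?thesis by simp
  qed
  have "\<exists>m\<in>A. \<forall>a\<in>A. a \<le> m \<longrightarrow> a = m"
  proof (rule predicate_Zorn)
    show "partial_order_on A (relation_of (\<lambda>f g. g \<le> f) A)"
      by (rule partial_order_on_relation_ofI) auto
    fix C assume C: "C \<in> Chains (relation_of (\<lambda>f g. g \<le> f) A)"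
    then have CA: "C \<subseteq> A" by (rule Chains_relation_of)
    have chain: "j \<le> k \<or> k \<le> j" if "j \<in> C" "k \<in> C" for j k
      using C that unfolding Chains_def relation_of_def by blast
    show "\<exists>u\<in>A. \<forall>a\<in>C. u \<le> a"
    proof (cases "C = {}")
      case True
      with hA show ?thesis by blast
    next
      case False
      define u where "u x = (INF k\<in>C. k x)" for x
      have bdd: "bdd_below ((\<lambda>k. k x) ` C)" for x
        using lower CA by (intro bdd_belowI2[where m = "- h (- x)"]) auto
      have le: "u \<le> k" if "k \<in> C" for k
        unfolding u_def le_fun_def using that by (auto intro!: cINF_lower bdd)
      have "convex_on UNIV u"
        unfolding u_def using CA False chain bdd
        by (intro convex_on_Inf_chain) (auto simp: A_def)
      moreover have "u 0 = (INF k\<in>C. (0::real))"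
        unfolding u_def using CA by (intro INF_cong) (auto simp: A_def)
      then have "u 0 = 0" using False by simp
      moreover obtain k where "k \<in> C" using False by blast
      then have "u \<le> h" using le CA by (force simp: A_def intro: order_trans)
      ultimately have "u \<in> A" by (simp add: A_def)
      with le show ?thesis by blast
    qed
  qed
  then obtain l where l: "l \<in> A" and minimal: "\<And>a. a \<in> A \<Longrightarrow> a \<le> l \<Longrightarrow> a = l" by blast
  have "linear l"
  proof (rule minimal_convex_imp_linear)
    fix j assume "convex_on UNIV j" "j 0 = 0" "j \<le> l"
    then show "j = l" using l by (intro minimal) (auto simp: A_def intro: order_trans)
  qed (use l in \<open>auto simp: A_def\<close>)
  moreover have "l \<le> h" using l by (simp add: A_def)
  ultimately show thesis by (rule that)
qed

lemma linear_locally_bounded_above_imp_bounded_linear: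
  fixes l :: "'a::real_normed_vector \<Rightarrow> real"
  assumes lin: "linear l" and bound: "\<forall>\<^sub>F x in nhds 0. l x \<le> C"
  shows "bounded_linear l"
proof -
  interpret linear l by (rule lin)
  obtain d where d: "0 < d" and lC: "\<And>x. norm x < d \<Longrightarrow> l x \<le> C"
    using bound by (auto simp: eventually_nhds_metric)
  have abs: "\<bar>l x\<bar> \<le> C" if "norm x < d" for x
    using lC[OF that] lC[of "- x"] that by (simp add: neg abs_le_iff)
  have "norm (l x) \<le> norm x * (2 * C / d)" for x
  proof (cases "x = 0")
    case False
    define r where "r = d / (2 * norm x)"
    have r: "0 < r" using d False by (simp add: r_def)
    have "norm (r *\<^sub>R x) < d" using d False by (simp add: r_def)
    then have "\<bar>l (r *\<^sub>R x)\<bar> \<le> C" by (rule abs)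
    then have "r * \<bar>l x\<bar> \<le> C" using r by (simp add: scale abs_mult)
    then show ?thesis using d False by (simp add: r_def field_simps)
  qed (simp add: zero)
  then show ?thesis
    by (intro bounded_linear_intro[where K = "2 * C / d"]) (auto simp: add scale)
qed

text \<open>Translating \<open>a\<close> to the origin reduces this to a linear minorant, which inherits the local
  upper bound of \<open>h\<close> and is therefore continuous.\<close>

theorem convex_on_UNIV_subgradient:
  fixes h :: "'a::real_normed_vector \<Rightarrow> real"
  assumes conv: "convex_on UNIV h" and bound: "\<forall>\<^sub>F x in nhds a. h x \<le> C"
  obtains l :: "'a \<Rightarrow>\<^sub>L real" where "\<And>x. h a + blinfun_apply l (x - a) \<le> h x"
proof -
  define h' where "h' x = h (a + x) - h a" for x
  have "convex_on UNIV h'"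
    unfolding convex_on_def
  proof (intro conjI ballI allI impI convex_UNIV)
    fix x y :: 'a and u v :: real
    assume uv: "0 \<le> u" "0 \<le> v" "u + v = 1"
    have "h (u *\<^sub>R (a + x) + v *\<^sub>R (a + y)) \<le> u * h (a + x) + v * h (a + y)"
      using conv uv by (simp add: convex_on_def)
    moreover have "u *\<^sub>R (a + x) + v *\<^sub>R (a + y) = (u + v) *\<^sub>R a + (u *\<^sub>R x + v *\<^sub>R y)"
      by (simp add: algebra_simps)
    moreover have "u * h' x + v * h' y = u * h (a + x) + v * h (a + y) - (u + v) * h a"
      by (simp add: h'_def algebra_simps)
    ultimately show "h' (u *\<^sub>R x + v *\<^sub>R y) \<le> u * h' x + v * h' y"
      using uv by (simp add: h'_def)
  qed
  then obtain l where l: "linear l" "l \<le> h'"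
    using convex_on_UNIV_linear_minorant[of h'] by (auto simp: h'_def)
  have "((\<lambda>x. a + x) \<longlongrightarrow> a + 0) (nhds 0)"
    by (intro tendsto_intros filterlim_ident)
  then have "filterlim (\<lambda>x. a + x) (nhds a) (nhds 0)" by simp
  with bound have "\<forall>\<^sub>F x in nhds 0. h (a + x) \<le> C"
    by (rule eventually_compose_filterlim)
  then have "\<forall>\<^sub>F x in nhds 0. l x \<le> C - h a"
    using l(2) by (elim eventually_mono) (force simp: le_fun_def h'_def intro: order_trans)
  then have bl: "bounded_linear l"
    by (rule linear_locally_bounded_above_imp_bounded_linear[OF l(1)])
  show thesis
  proof (rule that)
    show "h a + blinfun_apply (Blinfun l) (x - a) \<le> h x" for x
      using l(2)[THEN le_funD, of "x - a"] by (simp add: bounded_linear_Blinfun_apply[OF bl] h'_def)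
  qed
qed

text \<open>Fenchel duality without conjugates. The functional is a subgradient at the origin of the value
  function \<open>h x = (INF y\<in>D. f y + g (y - x))\<close> of the perturbed minimization problem; taking
  \<open>x = y - w\<close> in the subgradient inequality decouples the two variables.\<close>

theorem convex_sandwich:
  fixes f g :: "'a::real_normed_vector \<Rightarrow> real"
  assumes f: "convex_on D f" and g: "convex_on UNIV g" and cont: "\<And>x. isCont g x"
    and ne: "D \<noteq> {}" and nonneg: "\<And>y. y \<in> D \<Longrightarrow> 0 \<le> f y + g y"
  obtains l :: "'a \<Rightarrow>\<^sub>L real"
  where "\<And>y w. y \<in> D \<Longrightarrow> blinfun_apply l y - blinfun_apply l w \<le> f y + g w"
proof -
  obtain y0 where y0: "y0 \<in> D" using ne by blast
  have D: "convex D" using f by (simp add: convex_on_def)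
  define \<Phi> where "\<Phi> x y = f y + g (y - x)" for x y
  define h where "h x = (INF y\<in>D. \<Phi> x y)" for x
  \<comment> \<open>The points \<open>y\<close>, \<open>y0\<close> fed to \<open>f\<close> and \<open>y - x\<close>, \<open>y0 + x\<close> fed to \<open>g\<close> share a midpoint, where
    \<open>f + g\<close> is nonnegative.\<close>
  have lower: "- (f y0 + g (y0 + x)) \<le> \<Phi> x y" if y: "y \<in> D" for x y
  proof -
    have mid: "(1/2) *\<^sub>R (y + y0) \<in> D"
      using convexD[OF D y y0, of "1/2" "1/2"] by (simp add: scaleR_add_right)
    have "0 \<le> f ((1/2) *\<^sub>R (y + y0)) + g ((1/2) *\<^sub>R (y + y0))" by (rule nonneg[OF mid])
    also have "\<dots> \<le> (f y + f y0) / 2 + (g (y - x) + g (y0 + x)) / 2"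
    proof (rule add_mono)
      show "f ((1/2) *\<^sub>R (y + y0)) \<le> (f y + f y0) / 2"
        using convex_onD[OF f _ _ y y0, of "1/2"] by (simp add: scaleR_add_right)
      show "g ((1/2) *\<^sub>R (y + y0)) \<le> (g (y - x) + g (y0 + x)) / 2"
        using convex_on_UNIV_midpoint[OF g, of "y - x" "y0 + x"] by simp
    qed
    finally show ?thesis unfolding \<Phi>_def by argo
  qed
  then have bdd: "bdd_below (\<Phi> x ` D)" for x by (intro bdd_belowI2)
  have h_le: "h x \<le> \<Phi> x y" if "y \<in> D" for x y
    unfolding h_def by (rule cINF_lower[OF bdd that])
  have "convex_on UNIV h"
    unfolding h_def
  proof (rule convex_on_marginal)
    show "convex_on (UNIV \<times> D) (\<lambda>(x, y). \<Phi> x y)"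
      unfolding convex_on_def
    proof (intro conjI ballI allI impI)
      fix p q :: "'a \<times> 'a" and u v :: real
      assume pD: "p \<in> UNIV \<times> D" and qD: "q \<in> UNIV \<times> D" and uv: "0 \<le> u" "0 \<le> v" "u + v = 1"
      obtain x1 y1 x2 y2 where pq: "p = (x1, y1)" "q = (x2, y2)" by (meson surj_pair)
      have "g (u *\<^sub>R (y1 - x1) + v *\<^sub>R (y2 - x2)) \<le> u * g (y1 - x1) + v * g (y2 - x2)"
        using g uv by (simp add: convex_on_def)
      moreover have "u *\<^sub>R (y1 - x1) + v *\<^sub>R (y2 - x2)
          = (u *\<^sub>R y1 + v *\<^sub>R y2) - (u *\<^sub>R x1 + v *\<^sub>R x2)"
        by (simp add: algebra_simps)
      moreover have "f (u *\<^sub>R y1 + v *\<^sub>R y2) \<le> u * f y1 + v * f y2"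
        using f uv pD qD pq by (simp add: convex_on_def)
      ultimately show "(case u *\<^sub>R p + v *\<^sub>R q of (x, y) \<Rightarrow> \<Phi> x y)
          \<le> u * (case p of (x, y) \<Rightarrow> \<Phi> x y) + v * (case q of (x, y) \<Rightarrow> \<Phi> x y)"
        by (simp add: pq \<Phi>_def distrib_left)
    qed (simp add: convex_Times D)
  qed (use bdd ne in auto)
  moreover have "\<forall>\<^sub>F x in nhds 0. h x \<le> f y0 + g y0 + 1"
  proof -
    have "isCont (\<lambda>x. g (y0 - x)) 0"
      by (rule isCont_o2[where f = "\<lambda>x. y0 - x" and g = g]) (simp_all add: cont)
    then have "((\<lambda>x. g (y0 - x)) \<longlongrightarrow> g (y0 - 0)) (nhds 0)"
      unfolding isCont_def
      by (rule tendsto_at_iff_tendsto_nhds[where g = "\<lambda>x. g (y0 - x)", THEN iffD1])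
    then have "\<forall>\<^sub>F x in nhds 0. g (y0 - x) < g y0 + 1"
      by (rule order_tendstoD) simp
    then show ?thesis
    proof (rule eventually_mono)
      fix x assume "g (y0 - x) < g y0 + 1"
      then show "h x \<le> f y0 + g y0 + 1"
        using h_le[OF y0, of x] by (simp add: \<Phi>_def)
    qed
  qed
  ultimately obtain l :: "'a \<Rightarrow>\<^sub>L real" where l: "\<And>x. h 0 + blinfun_apply l (x - 0) \<le> h x"
    using convex_on_UNIV_subgradient by blast
  have h0: "0 \<le> h 0"
    unfolding h_def using ne nonneg by (intro cINF_greatest) (auto simp: \<Phi>_def)
  show thesis
  proof (rule that)
    fix y w assume "y \<in> D"
    then show "blinfun_apply l y - blinfun_apply l w \<le> f y + g w"
      using h0 l[of "y - w"] h_le[of y "y - w"] by (simp add: \<Phi>_def blinfun.diff_right)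
  qed
qed

section \<open>Norms and half squared norms\<close>

lemma convex_on_norm_diff: "convex_on UNIV (\<lambda>x. norm (x - a))"
  for a :: "'a::real_normed_vector"
  using convex_on_dist[OF convex_UNIV, of a] by (simp add: dist_norm norm_minus_commute)

text \<open>A subgradient of the norm at \<open>x\<close> is a functional of norm at most one whose value at \<open>x\<close> is
  \<open>norm x\<close>.\<close>

lemma norm_bidual_embedding: "norm (bidual_embedding x) = norm x"
  for x :: "'a::real_normed_vector"
proof (rule antisym)
  show "norm (bidual_embedding x) \<le> norm x"
  proof (rule norm_blinfun_bound)
    show "norm (blinfun_apply (bidual_embedding x) f) \<le> norm x * norm f" for f
      using norm_blinfun[of f x] by (simp add: bidual_embedding_apply mult.commute)
  qed simp
  have conv: "convex_on UNIV (\<lambda>y::'a. norm y)"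
    using convex_on_norm_diff[of "0::'a"] by simp
  have "(norm \<longlongrightarrow> norm x) (nhds x)"
    by (intro tendsto_intros filterlim_ident)
  then have "\<forall>\<^sub>F y in nhds x. norm y < norm x + 1"
    by (rule order_tendstoD) simp
  then have "\<forall>\<^sub>F y in nhds x. norm y \<le> norm x + 1"
    by (rule eventually_mono) simp
  then obtain l :: "'a \<Rightarrow>\<^sub>L real"
    where l: "\<And>y. norm x + blinfun_apply l (y - x) \<le> norm y"
    using convex_on_UNIV_subgradient[OF conv] by blast
  have l_le: "blinfun_apply l y \<le> norm y" for y
    using l[of "x + y"] norm_triangle_ineq[of x y] by simp
  have "norm l \<le> 1"
  proof (rule norm_blinfun_bound)
    show "norm (blinfun_apply l y) \<le> 1 * norm y" for y
      using l_le[of y] l_le[of "- y"] by (simp add: blinfun.minus_right abs_le_iff)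
  qed simp
  have "norm x \<le> blinfun_apply l x"
    using l[of 0] by (simp add: blinfun.minus_right)
  also have "\<dots> \<le> norm (blinfun_apply (bidual_embedding x) l)"
    by (simp add: bidual_embedding_apply)
  also have "\<dots> \<le> norm (bidual_embedding x) * norm l" by (rule norm_blinfun)
  also have "\<dots> \<le> norm (bidual_embedding x)"
    using \<open>norm l \<le> 1\<close> by (simp add: mult_left_le)
  finally show "norm x \<le> norm (bidual_embedding x)" .
qed

text \<open>Optimizing over the multiples of a fixed \<open>v\<close> turns the hypothesis into
  \<open>(f v)\<^sup>2 \<le> 2 * c * (norm v)\<^sup>2\<close>; no maximizing \<open>v\<close> has to exist.\<close>

lemma half_square_norm_conjugate_lower:
  fixes f :: "'a::real_normed_vector \<Rightarrow>\<^sub>L real"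
  assumes bound: "\<And>v. blinfun_apply f v - (norm v)\<^sup>2 / 2 \<le> c"
  shows "(norm f)\<^sup>2 / 2 \<le> c"
proof -
  have c: "0 \<le> c" using bound[of 0] by simp
  have "norm f \<le> sqrt (2 * c)"
  proof (rule norm_blinfun_bound)
    fix v
    show "norm (blinfun_apply f v) \<le> sqrt (2 * c) * norm v"
    proof (cases "v = 0")
      case False
      \<comment> \<open>The maximizer of \<open>t \<mapsto> f (t *\<^sub>R v) - (norm (t *\<^sub>R v))\<^sup>2 / 2\<close>.\<close>
      define t where "t = blinfun_apply f v / (norm v)\<^sup>2"
      have "t * blinfun_apply f v - t\<^sup>2 * (norm v)\<^sup>2 / 2 \<le> c"
        using bound[of "t *\<^sub>R v"] by (simp add: blinfun.scaleR_right power_mult_distrib)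
      moreover have "t * blinfun_apply f v = (blinfun_apply f v)\<^sup>2 / (norm v)\<^sup>2"
        "t\<^sup>2 * (norm v)\<^sup>2 = (blinfun_apply f v)\<^sup>2 / (norm v)\<^sup>2"
        using False by (simp_all add: t_def power2_eq_square field_simps)
      ultimately have "(blinfun_apply f v)\<^sup>2 / (norm v)\<^sup>2 \<le> 2 * c" by simp
      then have "(blinfun_apply f v)\<^sup>2 \<le> 2 * c * (norm v)\<^sup>2"
        using False by (simp add: field_simps)
      then have "sqrt ((blinfun_apply f v)\<^sup>2) \<le> sqrt (2 * c * (norm v)\<^sup>2)"
        by (rule real_sqrt_le_mono)
      then show ?thesis by (simp add: real_sqrt_mult)
    qed simp
  qed (simp add: c)
  then have "(norm f)\<^sup>2 \<le> (sqrt (2 * c))\<^sup>2" by (intro power_mono) auto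
  with c show ?thesis by simp
qed

lemma convex_on_linear:
  assumes "linear l"
  shows "convex_on UNIV (l :: 'a::real_vector \<Rightarrow> real)"
  using assms by (simp add: convex_on_def linear_add linear_scale)

lemma convex_on_half_square_norm:
  "convex_on UNIV (\<lambda>x. (norm (x - a))\<^sup>2 / 2)" for a :: "'a::real_normed_vector"
proof (rule convex_on_cdiv)
  show "convex_on UNIV (\<lambda>x. (norm (x - a))\<^sup>2)"
    unfolding convex_on_def
  proof (intro conjI ballI allI impI convex_UNIV)
    fix x y :: 'a and u v :: real
    assume uv: "0 \<le> u" "0 \<le> v" "u + v = 1"
    have "norm (u *\<^sub>R x + v *\<^sub>R y - a) \<le> u * norm (x - a) + v * norm (y - a)"
      using convex_on_norm_diff[of a] uv by (simp add: convex_on_def)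
    then have "(norm (u *\<^sub>R x + v *\<^sub>R y - a))\<^sup>2 \<le> (u * norm (x - a) + v * norm (y - a))\<^sup>2"
      by (intro power_mono) auto
    also have "\<dots> \<le> u * (norm (x - a))\<^sup>2 + v * (norm (y - a))\<^sup>2"
      using convex_power2 uv by (simp add: convex_on_def)
    finally show "(norm (u *\<^sub>R x + v *\<^sub>R y - a))\<^sup>2 \<le> u * (norm (x - a))\<^sup>2 + v * (norm (y - a))\<^sup>2" .
  qed
qed simp

section \<open>Selfdual Lagrangians\<close>

lemma selfdual_lagrangian_fenchel_young:
  assumes "selfdual_lagrangian L"
  shows "ereal (blinfun_apply u' v + blinfun_apply v' u) \<le> L (u, u') + L (v, v')"
proof -
  have "ereal (blinfun_apply u' v + blinfun_apply v' u) - L (v, v') \<le> lagrangian_conjugate L (u', u)"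
    unfolding lagrangian_conjugate_def prod.case by (rule SUP_upper2[of "(v, v')"]) simp_all
  also have "\<dots> = L (u, u')" using assms by (simp add: selfdual_lagrangian_def)
  finally have "ereal (blinfun_apply u' v + blinfun_apply v' u) - L (v, v') \<le> L (u, u')" .
  moreover have "L (v, v') \<noteq> -\<infinity>" "L (u, u') \<noteq> -\<infinity>"
    using assms by (simp_all add: selfdual_lagrangian_def)
  ultimately show ?thesis
    by (cases "L (v, v')"; cases "L (u, u')") auto
qed

lemma selfdual_lagrangian_ge_pairing:
  assumes "selfdual_lagrangian L"
  shows "ereal (blinfun_apply u' u) \<le> L (u, u')"
  using selfdual_lagrangian_fenchel_young[OF assms, of u' u u' u]
  by (cases "L (u, u')") auto

lemma selfdual_lagrangian_leI:
  assumes L: "selfdual_lagrangian L"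
    and le: "\<And>v v'. L (v, v') \<noteq> \<infinity> \<Longrightarrow>
      blinfun_apply u' v + blinfun_apply v' u - real_of_ereal (L (v, v')) \<le> c"
  shows "L (u, u') \<le> ereal c"
proof -
  have "lagrangian_conjugate L (u', u) \<le> ereal c"
    unfolding lagrangian_conjugate_def prod.case
  proof (rule SUP_least, clarify)
    fix v v'
    have "L (v, v') \<noteq> -\<infinity>" using L by (simp add: selfdual_lagrangian_def)
    then show "ereal (blinfun_apply u' v + blinfun_apply v' u) - L (v, v') \<le> ereal c"
      using le[of v v'] by (cases "L (v, v')") auto
  qed
  then show ?thesis using L by (simp add: selfdual_lagrangian_def)
qed

lemma selfdual_lagrangian_proper:
  assumes L: "selfdual_lagrangian L"
  shows "{z. L z \<noteq> \<infinity>} \<noteq> {}"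
proof
  assume "{z. L z \<noteq> \<infinity>} = {}"
  then have top: "L z = \<infinity>" for z by blast
  have "L (0, 0) \<le> ereal 0" by (rule selfdual_lagrangian_leI[OF L]) (simp add: top)
  with top[of "(0, 0)"] show False by simp
qed

lemma convex_ereal_imp_convex_on_domain:
  assumes conv: "convex_ereal L" and ninf: "\<And>z. L z \<noteq> -\<infinity>"
  shows "convex_on {z. L z \<noteq> \<infinity>} (\<lambda>z. real_of_ereal (L z))"
proof -
  have *: "L (s *\<^sub>R x + t *\<^sub>R y) \<noteq> \<infinity> \<and>
      real_of_ereal (L (s *\<^sub>R x + t *\<^sub>R y)) \<le> s * real_of_ereal (L x) + t * real_of_ereal (L y)"
    if fin: "L x \<noteq> \<infinity>" "L y \<noteq> \<infinity>" and st: "0 \<le> s" "0 \<le> t" "s + t = 1" for x y s t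
  proof -
    obtain a b where ab: "L x = ereal a" "L y = ereal b"
      using fin ninf[of x] ninf[of y] by (cases "L x"; cases "L y") auto
    have "L (s *\<^sub>R x + t *\<^sub>R y) \<le> ereal s * L x + ereal t * L y"
      using conv st by (simp add: convex_ereal_def)
    then show ?thesis
      using ab ninf[of "s *\<^sub>R x + t *\<^sub>R y"] by (cases "L (s *\<^sub>R x + t *\<^sub>R y)") auto
  qed
  then show ?thesis unfolding convex_on_def convex_def by blast
qed

text \<open>A Bronsted--Rockafellar property: the gap at \<open>(u, u')\<close> controls the distance to the graph of the
  vector field. When the gap is infinite the estimate is void, but the existence of \<open>(a, a')\<close> still
  shows that the graph is nonempty.\<close>

theorem selfdual_lagrangian_graph_near:
  fixes L :: "'a::banach \<times> ('a \<Rightarrow>\<^sub>L real) \<Rightarrow> ereal"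
  assumes refl: "reflexive_space TYPE('a)" and L: "selfdual_lagrangian L"
  obtains a a' where "(a, a') \<in> set_valued_graph (lagrangian_vector_field L)"
    "norm (a' - u') = norm (a - u)"
    "ereal ((norm (a - u))\<^sup>2) \<le> L (u, u') - ereal (blinfun_apply u' u)"
proof -
  define f where "f z = real_of_ereal (L z)" for z
  define D where "D = {z. L z \<noteq> \<infinity>}"
  define m where "m z = blinfun_apply u' (fst z) + blinfun_apply (snd z) u"
    for z :: "'a \<times> ('a \<Rightarrow>\<^sub>L real)"
  define g where "g z = (norm (z - (u, u')))\<^sup>2 / 2 + (- m z + blinfun_apply u' u)" for z
  have ninf: "L z \<noteq> -\<infinity>" for z using L unfolding selfdual_lagrangian_def by blast
  have fL: "L z = ereal (f z)" if "z \<in> D" for z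
    using that ninf[of z] by (cases "L z") (auto simp: D_def f_def)
  have sq: "(norm (z - (u, u')))\<^sup>2 = (norm (fst z - u))\<^sup>2 + (norm (snd z - u'))\<^sup>2" for z
    by (simp add: norm_prod_def)
  have "convex_on D f"
    using convex_ereal_imp_convex_on_domain[of L, OF _ ninf] L
    unfolding D_def f_def selfdual_lagrangian_def by blast
  moreover have "convex_on UNIV g"
    unfolding g_def
  proof (intro convex_on_add convex_on_half_square_norm)
    show "convex_on UNIV (\<lambda>z. - m z)"
      by (rule convex_on_linear)
        (auto intro!: linearI simp: m_def blinfun.add_left blinfun.add_right
          blinfun.scaleR_left blinfun.scaleR_right algebra_simps)
  qed (simp add: convex_on_const)
  moreover have "isCont g z" for z
    unfolding g_def m_def by (intro continuous_intros) auto
  moreover have "D \<noteq> {}" unfolding D_def by (rule selfdual_lagrangian_proper[OF L])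
  moreover have "0 \<le> f z + g z" if "z \<in> D" for z
  proof -
    let ?p = "norm (fst z - u)" and ?q = "norm (snd z - u')"
    have "ereal (blinfun_apply (snd z) (fst z)) \<le> L (fst z, snd z)"
      by (rule selfdual_lagrangian_ge_pairing[OF L])
    then have "blinfun_apply (snd z) (fst z) \<le> f z" by (simp add: fL[OF that])
    then have "blinfun_apply (snd z - u') (fst z - u) \<le> f z - m z + blinfun_apply u' u"
      by (simp add: m_def blinfun.diff_left blinfun.diff_right)
    moreover have "- (?q * ?p) \<le> blinfun_apply (snd z - u') (fst z - u)"
      using norm_blinfun[of "snd z - u'" "fst z - u"] by (simp add: abs_le_iff)
    moreover have "?q * ?p \<le> (?p\<^sup>2 + ?q\<^sup>2) / 2"
      using sum_squares_bound[of ?q ?p] by simp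
    ultimately show ?thesis unfolding g_def sq by linarith
  qed
  ultimately obtain l :: "('a \<times> ('a \<Rightarrow>\<^sub>L real)) \<Rightarrow>\<^sub>L real"
    where l: "\<And>y w. y \<in> D \<Longrightarrow> blinfun_apply l y - blinfun_apply l w \<le> f y + g w"
    using convex_sandwich[of D f g] by blast
  define a' where "a' = Blinfun (\<lambda>v. blinfun_apply l (v, 0))"
  define b where "b = Blinfun (\<lambda>v'. blinfun_apply l (0, v'))"
  have a': "blinfun_apply a' v = blinfun_apply l (v, 0)" for v
    unfolding a'_def
    by (subst bounded_linear_Blinfun_apply)
      (auto intro!: bounded_linear_compose[OF blinfun.bounded_linear_right]
        bounded_linear_Pair bounded_linear_ident bounded_linear_zero)
  have b: "blinfun_apply b v' = blinfun_apply l (0, v')" for v'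
    unfolding b_def
    by (subst bounded_linear_Blinfun_apply)
      (auto intro!: bounded_linear_compose[OF blinfun.bounded_linear_right]
        bounded_linear_Pair bounded_linear_ident bounded_linear_zero)
  obtain a where a: "b = bidual_embedding a"
    using refl unfolding reflexive_space_def by (metis surjD)
  have l_split: "blinfun_apply l (v, v') = blinfun_apply a' v + blinfun_apply v' a" for v v'
  proof -
    have "blinfun_apply l ((v, 0) + (0, v')) = blinfun_apply a' v + blinfun_apply b v'"
      by (simp only: blinfun.add_right a' b)
    then show ?thesis by (simp add: a bidual_embedding_apply)
  qed
  \<comment> \<open>Evaluating the separation at \<open>w = (u - v, u' - v')\<close> bounds the conjugate of \<open>L\<close>, hence \<open>L\<close>
    itself, by terms in which \<open>v\<close> and \<open>v'\<close> occur separately and can be optimized one after the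
    other.\<close>
  define K where "K = blinfun_apply a' u + blinfun_apply u' a - blinfun_apply u' u"
  have bound: "L (a, a') \<le> ereal (K
      - (blinfun_apply (a' - u') v - (norm v)\<^sup>2 / 2)
      - (blinfun_apply (bidual_embedding (a - u)) v' - (norm v')\<^sup>2 / 2))" for v v'
  proof (rule selfdual_lagrangian_leI[OF L])
    fix y y' assume "L (y, y') \<noteq> \<infinity>"
    then have "(y, y') \<in> D" by (simp add: D_def)
    then have "blinfun_apply l (y, y') - f (y, y')
        \<le> g (u - v, u' - v') + blinfun_apply l (u - v, u' - v')"
      using l[of "(y, y')" "(u - v, u' - v')"] by simp
    moreover have "g (u - v, u' - v') = ((norm v)\<^sup>2 + (norm v')\<^sup>2) / 2
        + (- m (u - v, u' - v') + blinfun_apply u' u)"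
      unfolding g_def sq by simp
    ultimately show "blinfun_apply a' y + blinfun_apply y' a - real_of_ereal (L (y, y'))
      \<le> K - (blinfun_apply (a' - u') v - (norm v)\<^sup>2 / 2)
        - (blinfun_apply (bidual_embedding (a - u)) v' - (norm v')\<^sup>2 / 2)"
      by (simp add: l_split m_def K_def f_def bidual_embedding_apply
          blinfun.diff_left blinfun.diff_right add_divide_distrib)
  qed
  have pair: "ereal (blinfun_apply a' a) \<le> L (a, a')"
    by (rule selfdual_lagrangian_ge_pairing[OF L])
  obtain r where r: "L (a, a') = ereal r"
    using bound[of 0 0] ninf[of "(a, a')"] by (cases "L (a, a')") auto
  let ?p = "norm (a - u)" and ?q = "norm (a' - u')"
  have "?q\<^sup>2 / 2 \<le> K - r - (blinfun_apply (bidual_embedding (a - u)) v' - (norm v')\<^sup>2 / 2)" for v'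
  proof (rule half_square_norm_conjugate_lower)
    show "blinfun_apply (a' - u') v - (norm v)\<^sup>2 / 2
        \<le> K - r - (blinfun_apply (bidual_embedding (a - u)) v' - (norm v')\<^sup>2 / 2)" for v
      using bound[of v v'] unfolding r ereal_less_eq by linarith
  qed
  then have "(norm (bidual_embedding (a - u)))\<^sup>2 / 2 \<le> K - r - ?q\<^sup>2 / 2"
    by (intro half_square_norm_conjugate_lower) (simp add: algebra_simps)
  then have pq: "?p\<^sup>2 / 2 + ?q\<^sup>2 / 2 \<le> K - r" by (simp add: norm_bidual_embedding)
  have ra: "blinfun_apply a' a \<le> r" using pair r by simp
  have "blinfun_apply (a' - u') (a - u) = blinfun_apply a' a - K"
    by (simp add: K_def blinfun.diff_left blinfun.diff_right)
  moreover have "\<bar>blinfun_apply (a' - u') (a - u)\<bar> \<le> ?q * ?p"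
    using norm_blinfun[of "a' - u'" "a - u"] by simp
  ultimately have Kr: "K - blinfun_apply a' a \<le> ?q * ?p" by simp
  with pq ra have "(?q - ?p)\<^sup>2 \<le> 0" by (simp add: power2_diff)
  then have eq: "?q = ?p" by simp
  show thesis
  proof (rule that[OF _ eq])
    have "r = blinfun_apply a' a"
      using pq ra Kr by (simp add: eq power2_eq_square)
    then show "(a, a') \<in> set_valued_graph (lagrangian_vector_field L)"
      by (simp add: set_valued_graph_def lagrangian_vector_field_def r)
    have "ereal (blinfun_apply a' u + blinfun_apply u' a) \<le> ereal r + L (u, u')"
      using selfdual_lagrangian_fenchel_young[OF L, of a' u u' a] by (simp add: r)
    then show "ereal (?p\<^sup>2) \<le> L (u, u') - ereal (blinfun_apply u' u)"
      using pq ninf[of "(u, u')"] by (cases "L (u, u')") (auto simp: eq K_def)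
  qed
qed

section \<open>Convergence of graphs\<close>

lemma kuratowski_Li_subset_Ls: "kuratowski_Li A \<subseteq> kuratowski_Ls A"
  unfolding kuratowski_Li_def kuratowski_Ls_def using filterlim_ident by blast

lemma filterlim_at_top_strict_mono_subseq:
  fixes r :: "nat \<Rightarrow> nat"
  assumes r: "filterlim r at_top sequentially"
  obtains s :: "nat \<Rightarrow> nat" where "strict_mono s" "strict_mono (r \<circ> s)"
proof -
  have step: "\<exists>j. k < j \<and> r k < r j" for k
  proof -
    have "\<forall>\<^sub>F j in sequentially. r k < r j"
      using r[unfolded filterlim_at_top, rule_format, of "Suc (r k)"] by (simp add: Suc_le_eq)
    then have "\<forall>\<^sub>F j in sequentially. k < j \<and> r k < r j"
      by (intro eventually_conj eventually_gt_at_top)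
    from eventually_happens[OF this] show ?thesis by simp
  qed
  have "\<exists>s. \<forall>n. True \<and> s n < s (Suc n) \<and> r (s n) < r (s (Suc n))"
    by (rule dependent_nat_choice) (use step in auto)
  then show thesis using that by (auto simp: strict_mono_Suc_iff)
qed

text \<open>The liminf inequality speaks of full sequences. A sequence indexed by \<open>r\<close> is thinned until the
  indices increase strictly and the gaps are then filled with the constant value \<open>x\<close>, which preserves
  convergence to \<open>x\<close>.\<close>

lemma gamma_liminf_along_subsequence:
  assumes gamma: "gamma_converges F G"
    and r: "filterlim r at_top sequentially" and p: "p \<longlonglongrightarrow> x"
    and conv: "(\<lambda>k. F (r k) (p k)) \<longlonglongrightarrow> c"
  shows "G x \<le> c"
proof -
  obtain s :: "nat \<Rightarrow> nat" where s: "strict_mono s" "strict_mono (r \<circ> s)"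
    by (rule filterlim_at_top_strict_mono_subseq[OF r])
  let ?t = "r \<circ> s"
  define q where "q n = (if n \<in> range ?t then p (s (inv ?t n)) else x)" for n
  have inj: "inj ?t" using s(2) by (rule strict_mono_imp_inj_on)
  have qt: "q (?t k) = p (s k)" for k
    using inv_f_f[OF inj, of k] by (simp add: q_def)
  have ps: "(p \<circ> s) \<longlonglongrightarrow> x" by (rule LIMSEQ_subseq_LIMSEQ[OF p s(1)])
  have "q \<longlonglongrightarrow> x"
  proof (rule topological_tendstoI)
    fix S assume S: "open S" "x \<in> S"
    with ps obtain N where N: "\<And>k. N \<le> k \<Longrightarrow> p (s k) \<in> S"
      by (auto simp: tendsto_def eventually_sequentially)
    have "q n \<in> S" if n: "?t N \<le> n" for n
    proof (cases "n \<in> range ?t")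
      case True
      then obtain k where k: "n = ?t k" by blast
      with n have "N \<le> k" using strict_mono_less_eq[OF s(2)] by blast
      then have "p (s k) \<in> S" by (rule N)
      then show ?thesis using k qt by simp
    qed (use S in \<open>simp add: q_def\<close>)
    then show "\<forall>\<^sub>F n in sequentially. q n \<in> S" by (auto simp: eventually_sequentially)
  qed
  with gamma have "G x \<le> liminf (\<lambda>n. F n (q n))" by (simp add: gamma_converges_def)
  also have "\<dots> \<le> liminf ((\<lambda>n. F n (q n)) \<circ> ?t)"
    by (rule liminf_subseq_mono[OF s(2)])
  also have "(\<lambda>n. F n (q n)) \<circ> ?t = (\<lambda>k. F (r k) (p k)) \<circ> s"
    using qt by (auto simp: fun_eq_iff)
  also have "liminf \<dots> = c"
    using LIMSEQ_subseq_LIMSEQ[OF conv s(1)] by (intro lim_imp_Liminf) auto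
  finally show ?thesis .
qed

text \<open>Membership in the lower limit asks for a graph point \<open>q n\<close> for every \<open>n\<close>, not just eventually;
  hence the graph points near the recovery sequence are chosen also at those \<open>n\<close> where its gap is
  infinite.\<close>

theorem theorem2p4:
  fixes F :: "nat \<Rightarrow> 'a::banach \<times> ('a \<Rightarrow>\<^sub>L real) \<Rightarrow> ereal"
    and G :: "'a \<times> ('a \<Rightarrow>\<^sub>L real) \<Rightarrow> ereal"
  assumes "reflexive_space TYPE('a)"
    and "\<And>n. selfdual_lagrangian (F n)"
    and "selfdual_lagrangian G"
    and "gamma_converges F G"
  shows "kuratowski_painleve_converges
    (\<lambda>n. set_valued_graph (lagrangian_vector_field (F n)))
    (set_valued_graph (lagrangian_vector_field G))"
proof -
  let ?A = "\<lambda>n. set_valued_graph (lagrangian_vector_field (F n))"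
  let ?B = "set_valued_graph (lagrangian_vector_field G)"
  have pairing: "(\<lambda>n. ereal (blinfun_apply (snd (p n)) (fst (p n)))) \<longlonglongrightarrow> ereal (blinfun_apply u' u)"
    if "p \<longlonglongrightarrow> (u, u')" for p :: "nat \<Rightarrow> 'a \<times> ('a \<Rightarrow>\<^sub>L real)" and u u'
    using tendsto_fst[OF that] tendsto_snd[OF that] by (auto intro!: tendsto_intros)
  have "kuratowski_Ls ?A \<subseteq> ?B"
  proof clarify
    fix u u' assume "(u, u') \<in> kuratowski_Ls ?A"
    then obtain r p where r: "filterlim r at_top sequentially"
      and pA: "\<And>k. p k \<in> ?A (r k)" and p: "p \<longlonglongrightarrow> (u, u')"
      by (auto simp: kuratowski_Ls_def)
    have "F (r k) (p k) = ereal (blinfun_apply (snd (p k)) (fst (p k)))" for k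
      using pA[of k] by (cases "p k") (simp add: set_valued_graph_def lagrangian_vector_field_def)
    then have "G (u, u') \<le> ereal (blinfun_apply u' u)"
      using pairing[OF p] by (intro gamma_liminf_along_subsequence[OF assms(4) r p]) simp
    with selfdual_lagrangian_ge_pairing[OF assms(3), of u' u]
    show "(u, u') \<in> ?B"
      by (simp add: set_valued_graph_def lagrangian_vector_field_def)
  qed
  moreover have "?B \<subseteq> kuratowski_Li ?A"
  proof clarify
    fix u u' assume "(u, u') \<in> ?B"
    then have Gu: "G (u, u') = ereal (blinfun_apply u' u)"
      by (simp add: set_valued_graph_def lagrangian_vector_field_def)
    obtain p where p: "p \<longlonglongrightarrow> (u, u')" and Fp: "(\<lambda>n. F n (p n)) \<longlonglongrightarrow> G (u, u')"
      using assms(4) unfolding gamma_converges_def by blast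
    define \<epsilon> where "\<epsilon> n = F n (p n) - ereal (blinfun_apply (snd (p n)) (fst (p n)))" for n
    have "\<exists>q. q \<in> ?A n \<and> norm (snd q - snd (p n)) = norm (fst q - fst (p n)) \<and>
        ereal ((norm (fst q - fst (p n)))\<^sup>2) \<le> \<epsilon> n" for n
      using selfdual_lagrangian_graph_near[OF assms(1,2), of n "snd (p n)" "fst (p n)"]
      unfolding \<epsilon>_def by (metis fst_conv prod.collapse snd_conv)
    then obtain q where q: "\<And>n. q n \<in> ?A n"
      and q_eq: "\<And>n. norm (snd (q n) - snd (p n)) = norm (fst (q n) - fst (p n))"
      and q_le: "\<And>n. ereal ((norm (fst (q n) - fst (p n)))\<^sup>2) \<le> \<epsilon> n"
      by metis
    have "\<epsilon> \<longlonglongrightarrow> G (u, u') - ereal (blinfun_apply u' u)"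
      unfolding \<epsilon>_def by (intro tendsto_diff_ereal Fp pairing[OF p]) (simp_all add: Gu)
    then have "\<epsilon> \<longlonglongrightarrow> ereal 0" by (simp add: Gu flip: zero_ereal_def)
    then have "(\<lambda>n. ereal ((norm (fst (q n) - fst (p n)))\<^sup>2)) \<longlonglongrightarrow> ereal 0"
      by (rule tendsto_sandwich[OF _ _ tendsto_const, rotated 2]) (simp_all add: q_le)
    then have "(\<lambda>n. (norm (fst (q n) - fst (p n)))\<^sup>2) \<longlonglongrightarrow> 0"
      by simp
    then have "(\<lambda>n. sqrt (2 * (norm (fst (q n) - fst (p n)))\<^sup>2)) \<longlonglongrightarrow> sqrt (2 * 0)"
      by (intro tendsto_intros)
    moreover have norm_qp: "norm (q n - p n) = sqrt (2 * (norm (fst (q n) - fst (p n)))\<^sup>2)" for n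
      by (simp add: norm_prod_def q_eq)
    ultimately have "(\<lambda>n. norm (q n - p n)) \<longlonglongrightarrow> 0"
      by (simp only: norm_qp mult_zero_right real_sqrt_zero)
    then have "(\<lambda>n. q n - p n) \<longlonglongrightarrow> 0" by (rule tendsto_norm_zero_cancel)
    from tendsto_add[OF this p] have "q \<longlonglongrightarrow> (u, u')" by simp
    with q show "(u, u') \<in> kuratowski_Li ?A" by (auto simp: kuratowski_Li_def)
  qed
  ultimately show ?thesis
    using kuratowski_Li_subset_Ls[of ?A] unfolding kuratowski_painleve_converges_def by blast
qed

end
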